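(* Let $(X_n)_{n\ge 0}$ be the elephant random walk with full (uniform) memory, with memory parameter $p\in[0,1]$ and first-step parameter $r\in[0,1]$. If $p\le 3/4$, then the walk $(X_n)_{n\ge0}$ is recurrent.
   Context: The elephant random walk (ERW) with full memory and parameters $p,r\in[0,1]$ is the process on $\mathbb{Z}$ defined by $X_0=0$ and $X_{n+1}=X_n+\eta_{n+1}$, where the steps $\eta_k\in\{-1,1\}$ are generated as follows. First, $\eta_1=1$ with probability $r$ and $\eta_1=-1$ with probability $1-r$. For $n\ge1$, given $\eta_1,\dots,\eta_n$, an index $n'$ is chosen uniformly at random from $\{1,\dots,n\}$, and then $\eta_{n+1}=\eta_{n'}$ with probability $p$ and $\eta_{n+1}=-\eta_{n'}$ with probability $1-p$. Equivalently, $\mathbb{P}[\eta_{n+1}=\eta\mid\eta_1,\dots,\eta_n]=\frac{1}{2n}\sum_{k=1}^n[1+(2p-1)\eta_k\eta]$ for $\eta=\pm1$, $n\ge1$. The walk is called recurrent if $\mathbb{P}\left[\liminf_{n\to\infty}X_n=-\infty \text{ and } \limsup_{n\to\infty}X_n=+\infty\right]=1$ (since the steps are $\pm1$, this is equivalent to every integer being visited infinitely often almost surely). *)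

theory Defs
  imports "HOL-Probability.Probability"
begin

text \<open>
  Law of the step after time \<open>n \<ge> 1\<close>, given that the steps so far were \<open>e 1, \<dots>, e n\<close>:
  a uniformly chosen earlier step is repeated with probability \<open>p\<close> and reversed with
  probability \<open>1 - p\<close>.
\<close>

definition erw_step :: "real \<Rightarrow> nat \<Rightarrow> (nat \<Rightarrow> int) \<Rightarrow> int pmf" where
  "erw_step p n e =
     bind_pmf (pmf_of_set {1..n}) (\<lambda>k.
       map_pmf (\<lambda>b. if b then e k else - e k) (bernoulli_pmf p))"

text \<open>
  Nothing is assumed about \<open>\<eta> 0\<close>. Conditioning is elementary and is only prescribed on histories
  of positive probability, since \<^const>\<open>cond_prob\<close> is \<open>0\<close> on null events.
\<close>

locale elephant_random_walk = prob_space M for M :: "'a measure" +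
  fixes p r :: real and \<eta> X :: "nat \<Rightarrow> 'a \<Rightarrow> int"
  assumes p: "p \<in> {0..1}" and r: "r \<in> {0..1}"
    and \<eta>_measurable: "\<And>k. k \<ge> 1 \<Longrightarrow> random_variable (count_space UNIV) (\<eta> k)"
    and \<eta>_values: "\<And>k \<omega>. k \<ge> 1 \<Longrightarrow> \<omega> \<in> space M \<Longrightarrow> \<eta> k \<omega> \<in> {-1, 1}"
    and first_step_up: "\<P>(\<omega> in M. \<eta> 1 \<omega> = 1) = r"
    and first_step_down: "\<P>(\<omega> in M. \<eta> 1 \<omega> = -1) = 1 - r"
    and next_step: "\<And>n e s. n \<ge> 1 \<Longrightarrow> s \<in> {-1, 1} \<Longrightarrow>
          \<P>(\<omega> in M. \<forall>k\<in>{1..n}. \<eta> k \<omega> = e k) > 0 \<Longrightarrow>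
          \<P>(\<omega> in M. \<eta> (n + 1) \<omega> = s \<bar> \<forall>k\<in>{1..n}. \<eta> k \<omega> = e k) = pmf (erw_step p n e) s"
    and X_0: "\<And>\<omega>. \<omega> \<in> space M \<Longrightarrow> X 0 \<omega> = 0"
    and X_Suc: "\<And>n \<omega>. \<omega> \<in> space M \<Longrightarrow> X (n + 1) \<omega> = X n \<omega> + \<eta> (n + 1) \<omega>"

definition recurrent_walk :: "'a measure \<Rightarrow> (nat \<Rightarrow> 'a \<Rightarrow> int) \<Rightarrow> bool" where
  "recurrent_walk M X \<longleftrightarrow>
     \<P>(\<omega> in M. liminf (\<lambda>n. ereal (real_of_int (X n \<omega>))) = - \<infinity> \<and>
               limsup (\<lambda>n. ereal (real_of_int (X n \<omega>))) = \<infinity>) = 1"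

lemma pmf_erw_step:
  assumes "p \<in> {0..1}" and n: "n \<ge> 1" and e: "\<And>k. k \<in> {1..n} \<Longrightarrow> e k \<in> {-1, 1}"
    and s: "s \<in> {-1, 1}"
  shows "pmf (erw_step p n e) s =
    1 / (2 * real n) * (\<Sum>k=1..n. 1 + (2 * p - 1) * real_of_int (e k) * real_of_int s)"
proof -
  have step: "pmf (map_pmf (\<lambda>b. if b then e k else - e k) (bernoulli_pmf p)) s =
      (1 + (2 * p - 1) * real_of_int (e k) * real_of_int s) / 2" if "k \<in> {1..n}" for k
  proof -
    have "pmf (map_pmf (\<lambda>b. if b then e k else - e k) (bernoulli_pmf p)) s =
        (\<integral>b. indicator {s} (if b then e k else - e k) \<partial>bernoulli_pmf p)"
      by (subst map_pmf_def, subst pmf_bind) (auto intro!: Bochner_Integration.integral_cong simp: indicator_def)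
    also have "\<dots> = p * indicator {s} (e k) + (1 - p) * indicator {s} (- e k)"
      using assms(1) by simp
    also have "\<dots> = (1 + (2 * p - 1) * real_of_int (e k) * real_of_int s) / 2"
      using e[OF that] s by (auto simp: field_simps)
    finally show ?thesis .
  qed
  have "pmf (erw_step p n e) s =
      (\<Sum>k\<in>{1..n}. pmf (map_pmf (\<lambda>b. if b then e k else - e k) (bernoulli_pmf p)) s) / real n"
    using n by (simp add: erw_step_def pmf_bind integral_pmf_of_set)
  also have "\<dots> = (\<Sum>k=1..n. (1 + (2 * p - 1) * real_of_int (e k) * real_of_int s) / 2) / real n"
    by (rule arg_cong[where f = "\<lambda>x. x / real n"], rule sum.cong[OF refl], rule step)
  finally show ?thesis
    by (simp add: sum_divide_distrib[symmetric])
qed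

end

theory Submission
  imports Defs "HOL-Real_Asymp.Real_Asymp"
begin

text \<open>
  Write \<open>\<alpha> = 2 p - 1 \<le> 1 / 2\<close> and let \<open>s = \<plusminus>1\<close>. Given the past, \<open>s X\<close> goes up with probability
  \<open>(1 + \<alpha> s X\<^sub>n / n) / 2\<close>. For fixed \<open>m\<close> consider \<open>V\<^sub>n = sqrt (1 + (s X\<^sub>n + m) / sqrt (2 n - 1))\<close>. As long
  as \<open>s X > - m\<close> and \<open>n\<close> is large, \<open>V\<close> is a supermartingale, and its expected decrease is at least
  \<open>c\<^sub>K / n\<close> where \<open>V\<^sub>n < K\<close>. Let \<open>v\<^sub>n\<close> be the expectation of \<open>V\<^sub>n\<close> on the event \<open>D\<^sub>n\<close> that \<open>s X\<close> has stayed
  above \<open>- m\<close>. Then \<open>v\<close> decreases, with \<open>v\<^sub>n\<^sub>+\<^sub>1 \<le> v\<^sub>n - c\<^sub>K / n * (P(D\<^sub>n) - v\<^sub>n / K)\<close>; if \<open>P(D\<^sub>n)\<close> stayed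
  above \<open>\<rho> > 0\<close>, a choice of \<open>K\<close> with \<open>v / K \<le> \<rho> / 2\<close> would contradict the divergence of the harmonic
  series. Hence \<open>s X\<close> almost surely falls to \<open>- m\<close> after any time, for both signs and every \<open>m\<close>.
\<close>

section \<open>Estimates for the Lyapunov function\<close>

text \<open>With \<open>a = sqrt t\<close> and \<open>b = sqrt t'\<close>, the identity
  \<open>b - a = ((b^2 - a^2) - (b - a)^2) / (2 a)\<close> is exact. The square is bounded below
  through \<open>(b - a)^2 (b + a)^2 = (t' - t)^2\<close> and
  \<open>(b + a)^2 \<le> 2 (t + t') \<le> 4 (t + 1)\<close>.\<close>

lemma sqrt_le_second_order:
  fixes t t' :: real
  assumes "0 < t" "0 \<le> t'" "t' \<le> t + 1"
  shows "sqrt t' \<le> sqrt t + ((t' - t) - (t' - t)\<^sup>2 / (4 * (t + 1))) / (2 * sqrt t)"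
proof -
  define a b where "a = sqrt t" and "b = sqrt t'"
  have a: "a > 0" "a\<^sup>2 = t" and b: "b \<ge> 0" "b\<^sup>2 = t'"
    using assms by (auto simp: a_def b_def)
  have "0 \<le> (b - a)\<^sup>2" by simp
  then have "(b + a)\<^sup>2 \<le> 4 * (t + 1)"
    using assms a b by (simp add: power2_eq_square algebra_simps)
  then have "(b - a)\<^sup>2 * (b + a)\<^sup>2 \<le> (b - a)\<^sup>2 * (4 * (t + 1))"
    by (intro mult_left_mono) auto
  moreover have "(b - a)\<^sup>2 * (b + a)\<^sup>2 = (t' - t)\<^sup>2"
    unfolding a(2)[symmetric] b(2)[symmetric] by (simp add: power2_eq_square algebra_simps)
  ultimately have "(t' - t)\<^sup>2 / (4 * (t + 1)) \<le> (b - a)\<^sup>2"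
    using assms by (simp add: divide_simps)
  then have "((t' - t) - (b - a)\<^sup>2) / (2 * a) \<le> ((t' - t) - (t' - t)\<^sup>2 / (4 * (t + 1))) / (2 * a)"
    using a by (intro divide_right_mono) auto
  moreover have "((t' - t) - (b - a)\<^sup>2) / (2 * a) = b - a"
    unfolding a(2)[symmetric] b(2)[symmetric] using a by (simp add: field_simps power2_eq_square)
  ultimately show ?thesis by (simp add: a_def b_def)
qed

text \<open>
  In \<open>E(\<surd>t') - \<surd>t\<close> the concavity correction has the order of \<open>1 / n\<close> (on bounded values of \<open>t\<close>), which
  beats the drift of order \<open>m / n\<^sup>3\<^sup>/\<^sup>2\<close> that negative \<open>\<alpha>\<close> produces for \<open>- m < x < 0\<close>. The scaling
  \<open>sqrt (2 n - 1)\<close> grows at least by the factor \<open>1 + 1 / (2 n)\<close> in each step, which absorbs the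
  drift away from the origin for all \<open>\<alpha> \<le> 1 / 2\<close>.
\<close>

definition lyap :: "real \<Rightarrow> nat \<Rightarrow> real \<Rightarrow> real" where
  "lyap m n x = sqrt (1 + (x + m) / sqrt (2 * real n - 1))"

lemma lyap_nonneg: "n \<ge> 1 \<Longrightarrow> x + m \<ge> 0 \<Longrightarrow> lyap m n x \<ge> 0"
  by (simp add: lyap_def)

text \<open>The second-order bound is averaged over an up-step of probability
  \<open>(1 + d) / 2\<close> and a down-step of probability \<open>(1 - d) / 2\<close>. The mean
  change of the argument of the root is \<open>\<delta>\<close>; of its second moment only the
  variance is kept. Since \<open>x + m \<ge> 1\<close>, the argument stays nonnegative after a
  down-step.\<close>

lemma lyap_step:
  fixes x m d :: real and n :: nat
  assumes n: "n \<ge> 1" and y: "x + m \<ge> 1" and d: "\<bar>d\<bar> \<le> 1"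
  defines "t \<equiv> 1 + (x + m) / sqrt (2 * real n - 1)"
    and "\<delta> \<equiv> (x + m + d) / sqrt (2 * real n + 1) - (x + m) / sqrt (2 * real n - 1)"
  shows "(1 + d) / 2 * lyap m (Suc n) (x + 1) + (1 - d) / 2 * lyap m (Suc n) (x - 1)
    \<le> sqrt t + (\<delta> - (1 - d\<^sup>2) / (4 * (2 * real n + 1) * (t + 1))) / (2 * sqrt t)"
proof -
  define A B where "A = sqrt (2 * real n - 1)" and "B = sqrt (2 * real n + 1)"
  have AB: "1 \<le> A" "A \<le> B" "B\<^sup>2 = 2 * real n + 1"
    using n by (auto simp: A_def B_def)
  have t: "t = 1 + (x + m) / A" "t \<ge> 1" using AB y by (auto simp: t_def A_def)
  define u w where "u = 1 + (x + m + 1) / B" and "w = 1 + (x + m - 1) / B"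
  have u: "lyap m (Suc n) (x + 1) = sqrt u" and w: "lyap m (Suc n) (x - 1) = sqrt w"
    by (simp_all add: lyap_def u_def w_def B_def algebra_simps)
  have "(x + m) / B \<le> (x + m) / A" "1 / B \<le> 1"
    using AB y by (auto intro!: divide_left_mono)
  moreover have "0 \<le> (x + m) / B" "0 \<le> 1 / B" "0 \<le> (x + m - 1) / B"
    using AB y by auto
  moreover have "u = 1 + (x + m) / B + 1 / B" "w = 1 + (x + m) / B - 1 / B"
    by (simp_all add: u_def w_def add_divide_distrib diff_divide_distrib)
  ultimately have ut: "u \<le> t + 1" "w \<le> t + 1" "0 \<le> u" "0 \<le> w"
    unfolding t by (linarith | simp add: u_def w_def)+
  let ?g = "\<lambda>s. sqrt t + ((s - t) - (s - t)\<^sup>2 / (4 * (t + 1))) / (2 * sqrt t)"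
  have "(1 + d) / 2 * sqrt u + (1 - d) / 2 * sqrt w \<le> (1 + d) / 2 * ?g u + (1 - d) / 2 * ?g w"
    using d ut t by (intro add_mono mult_left_mono sqrt_le_second_order) auto
  also have "\<dots> = sqrt t + (((1 + d) / 2 * (u - t) + (1 - d) / 2 * (w - t)) -
     ((1 + d) / 2 * (u - t)\<^sup>2 + (1 - d) / 2 * (w - t)\<^sup>2) / (4 * (t + 1))) / (2 * sqrt t)"
  proof -
    have "(1 + d) / 2 * (s + (x1 - x2 * P) * S) + (1 - d) / 2 * (s + (y1 - y2 * P) * S)
      = s + (((1 + d) / 2 * x1 + (1 - d) / 2 * y1) - ((1 + d) / 2 * x2 + (1 - d) / 2 * y2) * P) * S"
      for s x1 x2 y1 y2 P S :: real by (simp add: field_simps)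
    from this[of "sqrt t" "u - t" "(u - t)\<^sup>2" "inverse (4 * (t + 1))" "inverse (2 * sqrt t)"
        "w - t" "(w - t)\<^sup>2"]
    show ?thesis by (simp only: divide_inverse[of _ "4 * (t + 1)"] divide_inverse[of _ "2 * sqrt t"])
  qed
  also have "\<dots> \<le> sqrt t + (\<delta> - (1 - d\<^sup>2) / (2 * real n + 1) / (4 * (t + 1))) / (2 * sqrt t)"
  proof -
    define z where "z = 1 + (x + m) / B - t"
    have uz: "u - t = z + 1 / B" "w - t = z - 1 / B"
      by (auto simp: u_def w_def z_def add_divide_distrib diff_divide_distrib)
    \<comment> \<open>Mean and second moment of a two-point law on \<open>z + i\<close> and
      \<open>z - i\<close>; the second moment is the squared mean plus the variance
      \<open>(1 - d^2) i^2\<close>.\<close>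
    have "(1 + d) / 2 * (z + i) + (1 - d) / 2 * (z - i) = z + d * i"
      "(1 + d) / 2 * (z + i)\<^sup>2 + (1 - d) / 2 * (z - i)\<^sup>2 = (z + d * i)\<^sup>2 + (1 - d\<^sup>2) * i\<^sup>2"
      for i :: real
      by (simp_all add: field_simps power2_eq_square)
    from this[of "1 / B"] have 1: "(1 + d) / 2 * (u - t) + (1 - d) / 2 * (w - t) = \<delta>"
      and "(1 + d) / 2 * (u - t)\<^sup>2 + (1 - d) / 2 * (w - t)\<^sup>2
        = (z + d / B)\<^sup>2 + (1 - d\<^sup>2) / B\<^sup>2"
      unfolding uz by (simp_all add: z_def t \<delta>_def A_def[symmetric] B_def[symmetric]
        add_divide_distrib power_divide)
    then have 2: "(1 - d\<^sup>2) / (2 * real n + 1) \<le> (1 + d) / 2 * (u - t)\<^sup>2 + (1 - d) / 2 * (w - t)\<^sup>2"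
      using AB by simp
    show ?thesis unfolding 1
      using 2 t(2) by (intro add_left_mono divide_right_mono diff_left_mono) auto
  qed
  also have "\<dots> = sqrt t + (\<delta> - (1 - d\<^sup>2) / (4 * (2 * real n + 1) * (t + 1))) / (2 * sqrt t)"
    by (simp add: field_simps)
  finally show ?thesis unfolding u w .
qed

text \<open>Here \<open>d\<close> is the conditional mean of the next step. Half of the concavity
  gain \<open>Q\<close> pays for the mean change \<open>\<delta>\<close>, and the other half remains
  as the stated decrease.\<close>

lemma lyap_drift:
  fixes x m \<alpha> :: real and n :: nat
  assumes n: "n \<ge> 1" and m: "m \<ge> 0" and y: "x + m \<ge> 1" and x: "\<bar>x\<bar> \<le> real n"
    and \<alpha>: "-1 \<le> \<alpha>" "\<alpha> \<le> 1 / 2"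
    and n_large: "2 * m \<le> real n" "32 * m * (m + 2) \<le> sqrt (2 * real n + 1)"
  defines "d \<equiv> \<alpha> * x / real n"
  shows "(1 + d) / 2 * lyap m (Suc n) (x + 1) + (1 - d) / 2 * lyap m (Suc n) (x - 1)
    \<le> lyap m n x - (1 - d\<^sup>2) / (16 * (2 * real n + 1) * ((lyap m n x)\<^sup>2 + 1) * lyap m n x)"
proof -
  define A B where "A = sqrt (2 * real n - 1)" and "B = sqrt (2 * real n + 1)"
  have AB: "1 \<le> A" "A \<le> B" "B\<^sup>2 = 2 * real n + 1" "A\<^sup>2 = 2 * real n - 1"
    using n by (auto simp: A_def B_def)
  define t where "t = 1 + (x + m) / A"
  have t: "t \<ge> 1" using AB y by (auto simp: t_def)
  have ly: "lyap m n x = sqrt t" by (simp add: lyap_def t_def A_def)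
  define \<delta> where "\<delta> = (x + m + d) / B - (x + m) / A"
  have "\<bar>\<alpha> * x\<bar> \<le> 1 * real n" unfolding abs_mult using \<alpha> x by (intro mult_mono) auto
  then have d: "\<bar>d\<bar> \<le> 1" using n by (simp add: d_def divide_simps)
  then have d2: "d\<^sup>2 \<le> 1" by (simp add: abs_square_le_1)
  define Q where "Q = (1 - d\<^sup>2) / (4 * (2 * real n + 1) * (t + 1))"
  have Q0: "Q \<ge> 0" using d2 t by (simp add: Q_def)
  have step: "(1 + d) / 2 * lyap m (Suc n) (x + 1) + (1 - d) / 2 * lyap m (Suc n) (x - 1)
    \<le> sqrt t + (\<delta> - Q) / (2 * sqrt t)"
    using lyap_step[OF n y d] by (simp add: t_def \<delta>_def Q_def A_def B_def)
  \<comment> \<open>If \<open>d\<close> is at most \<open>(x + m) / (2 n)\<close>, the growth of the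
    scaling gives \<open>\<delta> \<le> 0\<close>. Otherwise \<open>\<alpha> \<le> 1 / 2\<close>
    forces \<open>x < 0\<close>, so that \<open>\<bar>x\<bar> \<le> m\<close> and the drift is small
    compared with \<open>Q\<close>.\<close>
  have "\<delta> \<le> Q / 2"
  proof (cases "d \<le> (x + m) / (2 * real n)")
    case True
    \<comment> \<open>The shift in \<open>2 n - 1\<close> matters: with \<open>sqrt (2 n)\<close>
      the squared ratio would be \<open>1 + 1 / n\<close>, just below
      \<open>(1 + 1 / (2 n))^2\<close>.\<close>
    have "(1 + 1 / (2 * real n))\<^sup>2 * A\<^sup>2 \<le> B\<^sup>2"
    proof -
      define i where "i = 1 / (2 * real n)"
      have i: "i * (2 * real n) = 1" "i > 0" using n by (auto simp: i_def)
      have "i\<^sup>2 * (2 * real n) = i" by (simp only: power2_eq_square mult.assoc i mult_1_right)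
      with i have "(1 + i)\<^sup>2 * (2 * real n - 1) = 2 * real n + 1 - i - i\<^sup>2"
        by (simp add: power2_sum algebra_simps)
      then show ?thesis unfolding AB i_def[symmetric] using i zero_le_power2[of i] by linarith
    qed
    then have "((1 + 1 / (2 * real n)) * A)\<^sup>2 \<le> B\<^sup>2"
      by (simp only: power_mult_distrib)
    moreover have "0 \<le> B" using AB by linarith
    ultimately have "(1 + 1 / (2 * real n)) * A \<le> B"
      by (rule power2_le_imp_le)
    then have "(x + m) * ((1 + 1 / (2 * real n)) * A) \<le> (x + m) * B"
      using y by (intro mult_left_mono) auto
    moreover have "x + m + d \<le> (1 + 1 / (2 * real n)) * (x + m)"
      using True by (simp add: algebra_simps add_divide_distrib)
    then have "(x + m + d) * A \<le> (x + m) * ((1 + 1 / (2 * real n)) * A)"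
      using AB mult_right_mono[of "x + m + d" _ A] by (simp add: mult_ac)
    ultimately have "(x + m + d) * A \<le> (x + m) * B" by (rule order_trans[rotated])
    then have "\<delta> \<le> 0"
      using AB by (simp add: \<delta>_def divide_simps)
    then show ?thesis using Q0 by simp
  next
    case False
    have "x < 0"
    proof (rule ccontr)
      assume "\<not> x < 0"
      then have "\<alpha> * x \<le> 1 / 2 * (x + m)" using \<alpha> m by (intro mult_mono) auto
      then show False using False n by (simp add: d_def divide_simps)
    qed
    then have xm: "\<bar>x\<bar> \<le> m" using y by simp
    have "\<bar>\<alpha> * x\<bar> \<le> 1 * m" unfolding abs_mult using \<alpha> xm by (intro mult_mono) auto
    then have dm: "\<bar>d\<bar> \<le> m / real n" using n by (simp add: d_def divide_simps)
    also have "\<dots> \<le> 1 / 2" using n_large n by (simp add: divide_simps)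
    finally have "\<bar>d\<bar>\<^sup>2 \<le> (1 / 2)\<^sup>2" by (intro power_mono) auto
    then have d34: "1 - d\<^sup>2 \<ge> 3 / 4" by (simp add: power2_eq_square)
    have "(x + m) / A \<le> m / 1" using AB \<open>x < 0\<close> y by (intro frac_le) auto
    then have tm: "t + 1 \<le> m + 2" by (simp add: t_def)
    have "(x + m) / B \<le> (x + m) / A" using AB y by (auto intro!: divide_left_mono)
    then have "\<delta> \<le> d / B" by (simp add: \<delta>_def add_divide_distrib)
    also have "\<dots> \<le> m / real n / B" using dm AB by (intro divide_right_mono) auto
    \<comment> \<open>The largeness condition with the constant 32 is tuned to this comparison: the
      left side has order \<open>1 / (n * B)\<close>, the right side order
      \<open>1 / n\<close>.\<close>
    also have "\<dots> \<le> (3 / 4) / (8 * B\<^sup>2 * (m + 2))"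
    proof -
      have "m * (32 * (m + 2)) * B \<le> B * B"
        using n_large AB by (intro mult_right_mono) (auto simp: B_def mult_ac)
      also have "\<dots> \<le> 3 * real n" using AB n by (simp add: power2_eq_square)
      finally have *: "m * (32 * (m + 2)) * B \<le> 3 * real n" .
      have "m / real n / B = m * (32 * (m + 2)) * B / (real n * (32 * (m + 2)) * B\<^sup>2)"
        using AB(1,2) m by (simp add: power2_eq_square)
      also have "\<dots> \<le> 3 * real n / (real n * (32 * (m + 2)) * B\<^sup>2)"
        using * m by (intro divide_right_mono) auto
      also have "\<dots> = (3 / 4) / (8 * B\<^sup>2 * (m + 2))"
        using n by simp
      finally show ?thesis .
    qed
    also have "\<dots> \<le> (1 - d\<^sup>2) / (8 * B\<^sup>2 * (t + 1))"
      using d34 tm t AB by (intro frac_le mult_left_mono) auto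
    also have "\<dots> = Q / 2" by (simp add: Q_def AB)
    finally show ?thesis .
  qed
  then have "(\<delta> - Q) / (2 * sqrt t) \<le> - (Q / 2) / (2 * sqrt t)"
    using t by (intro divide_right_mono) auto
  also have "\<dots> = - ((1 - d\<^sup>2) / (16 * (2 * real n + 1) * (t + 1) * sqrt t))"
    by (simp add: Q_def)
  finally show ?thesis using step t unfolding ly by simp
qed

text \<open>On a sublevel set of \<open>lyap\<close> the decrease becomes a constant over
  \<open>n\<close>, a rate whose sum diverges.\<close>

lemma lyap_drift_strict:
  fixes x m \<alpha> K :: real and n :: nat
  assumes n: "n \<ge> 1" and m: "m \<ge> 0" and y: "x + m \<ge> 1" and x: "\<bar>x\<bar> \<le> real n"
    and \<alpha>: "-1 \<le> \<alpha>" "\<alpha> \<le> 1 / 2"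
    and n_large: "2 * m \<le> real n" "32 * m * (m + 2) \<le> sqrt (2 * real n + 1)"
    and K: "lyap m n x < K" "4 * K ^ 4 \<le> real n"
  defines "d \<equiv> \<alpha> * x / real n"
  shows "(1 + d) / 2 * lyap m (Suc n) (x + 1) + (1 - d) / 2 * lyap m (Suc n) (x - 1)
    \<le> lyap m n x - 1 / (96 * (K\<^sup>2 + 1) * K) / real n"
proof -
  define A where "A = sqrt (2 * real n - 1)"
  have A: "1 \<le> A" "A\<^sup>2 = 2 * real n - 1"
    using n by (auto simp: A_def)
  define v where "v = lyap m n x"
  have "1 + (x + m) / A \<ge> 1" using A y by simp
  then have v: "v\<^sup>2 = 1 + (x + m) / A" "v \<ge> 1"
    by (auto simp: v_def lyap_def A_def)
  have vK: "v \<le> K" using K v_def by simp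
  \<comment> \<open>The variance factor must stay away from 0. For \<open>x \<ge> 0\<close> the
    bound \<open>K\<close> gives \<open>x \<le> K^2 * A\<close>, and
    \<open>4 * K ^ 4 \<le> n\<close> turns this into \<open>x^2 \<le> n^2 / 2\<close>; for
    \<open>x < 0\<close>, \<open>\<bar>x\<bar> \<le> m \<le> n / 2\<close>.\<close>
  have "d\<^sup>2 \<le> 1 / 2"
  proof (cases "x \<ge> 0")
    case True
    have "x \<le> v\<^sup>2 * A" using v A m by (simp add: field_simps)
    then have "x\<^sup>2 \<le> (v\<^sup>2 * A)\<^sup>2" using True by (intro power_mono) auto
    also have "\<dots> = v ^ 4 * (2 * real n - 1)" by (simp add: power_mult_distrib A)
    also have "\<dots> \<le> K ^ 4 * (2 * real n)"
      using vK v n by (intro mult_mono power_mono) auto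
    also have "\<dots> \<le> (real n)\<^sup>2 / 2" 
      using mult_right_mono[OF K(2), of "real n"] by (simp add: power2_eq_square mult_ac)
    finally have xx: "x\<^sup>2 \<le> (real n)\<^sup>2 / 2" .
    have "\<alpha>\<^sup>2 \<le> 1" using \<alpha> by (simp add: abs_square_le_1)
    then have "\<alpha>\<^sup>2 * x\<^sup>2 \<le> 1 * ((real n)\<^sup>2 / 2)" using xx by (intro mult_mono) auto
    then show ?thesis using n by (simp add: d_def power_mult_distrib power_divide divide_simps)
  next
    case False
    have "\<bar>\<alpha> * x\<bar> \<le> 1 * m" unfolding abs_mult using \<alpha> y False by (intro mult_mono) auto
    then have "\<bar>d\<bar> \<le> 1 / 2" using n n_large by (simp add: d_def divide_simps)
    then have "\<bar>d\<bar>\<^sup>2 \<le> (1 / 2)\<^sup>2" by (intro power_mono) auto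
    then show ?thesis by (simp add: power2_eq_square)
  qed
  moreover have "16 * (2 * real n + 1) * (v\<^sup>2 + 1) * v \<le> 16 * (3 * real n) * (K\<^sup>2 + 1) * K"
    using n v(2) vK by (intro mult_mono add_mono power_mono) auto
  moreover have "0 < 16 * (2 * real n + 1) * (v\<^sup>2 + 1) * v"
    using v(2) by (intro mult_pos_pos add_nonneg_pos) auto
  \<comment> \<open>This yields \<open>96 = 2 * 16 * 3\<close>, from
    \<open>1 - d^2 \<ge> 1 / 2\<close>, the 16 of \<open>lyap_drift\<close>, and
    \<open>2 n + 1 \<le> 3 n\<close>.\<close>
  ultimately have "(1 / 2) / (16 * (3 * real n) * (K\<^sup>2 + 1) * K)
      \<le> (1 - d\<^sup>2) / (16 * (2 * real n + 1) * (v\<^sup>2 + 1) * v)"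
    by (intro frac_le) auto
  with lyap_drift[OF n m y x \<alpha> n_large] show ?thesis
    unfolding d_def[symmetric] v_def[symmetric] by (simp add: mult_ac)
qed

text \<open>Telescoping bounds the partial sums of \<open>c / n\<close> by \<open>v N\<close>,
  against the divergence of the harmonic series.\<close>

lemma harmonic_descent_contradiction:
  fixes v :: "nat \<Rightarrow> real"
  assumes c: "c > 0" and v: "\<And>n. v n \<ge> 0"
    and step: "\<And>n. n \<ge> N \<Longrightarrow> v (Suc n) \<le> v n - c / real n"
  shows False
proof -
  have sum_le: "(\<Sum>k<n. c / real (k + N)) \<le> v N - v (n + N)" for n
  proof (induction n)
    case (Suc n)
    then show ?case using step[of "n + N"] by simp
  qed simp
  have "(\<Sum>k<n. c / real (k + N)) \<le> v N" for n
    using sum_le[of n] v[of "n + N"] by linarith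
  then have "summable (\<lambda>k. c / real (k + N))"
    using c by (intro summableI_nonneg_bounded) auto
  then have "summable (\<lambda>k. c * inverse (real k))"
    using summable_iff_shift[of "\<lambda>k. c * inverse (real k)" N] by (simp add: divide_inverse)
  then show False
    using c not_summable_harmonic[where 'a = real] by (simp add: summable_cmult_iff)
qed

section \<open>Finite histories and the law of the next step\<close>

text \<open>Positions are read off a bare step sequence, so that functionals of the process become
  functions of a finite history.\<close>

definition walk :: "(nat \<Rightarrow> int) \<Rightarrow> nat \<Rightarrow> int" where
  "walk e n = (\<Sum>k=1..n. e k)"

lemma walk_cong:
  "(\<And>k. k \<in> {1..n} \<Longrightarrow> e k = e' k) \<Longrightarrow> j \<le> n \<Longrightarrow> walk e j = walk e' j"
  unfolding walk_def by (rule sum.cong) auto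

context elephant_random_walk
begin

lemma X_eq_walk: "\<omega> \<in> space M \<Longrightarrow> X n \<omega> = walk (\<lambda>k. \<eta> k \<omega>) n"
  unfolding walk_def by (induction n) (use X_0 X_Suc in auto)

lemma abs_X_le:
  assumes "\<omega> \<in> space M"
  shows "\<bar>X n \<omega>\<bar> \<le> int n"
proof -
  have "\<bar>\<Sum>k=1..n. \<eta> k \<omega>\<bar> \<le> (\<Sum>k=1..n. \<bar>\<eta> k \<omega>\<bar>)" by (rule sum_abs)
  also have "\<dots> \<le> (\<Sum>k=1..n. 1)" using \<eta>_values assms by (intro sum_mono) fastforce
  finally show ?thesis using X_eq_walk[OF assms] by (simp add: walk_def)
qed

lemma \<eta>_measurable' [measurable]: "\<eta> (Suc k) \<in> measurable M (count_space UNIV)"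
  using \<eta>_measurable by simp

lemma X_measurable [measurable]: "X n \<in> measurable M (count_space UNIV)"
proof (induction n)
  case 0
  then show ?case using measurable_cong[of M "X 0" "\<lambda>_. 0"] X_0 by simp
next
  case (Suc n)
  note [measurable] = Suc
  have "(\<lambda>\<omega>. X n \<omega> + \<eta> (Suc n) \<omega>) \<in> measurable M (count_space UNIV)" by measurable
  then show ?case using measurable_cong[of M "X (Suc n)" "\<lambda>\<omega>. X n \<omega> + \<eta> (Suc n) \<omega>"] X_Suc by simp
qed

definition cylinder :: "nat \<Rightarrow> (nat \<Rightarrow> int) \<Rightarrow> 'a set" where
  "cylinder n e = {\<omega> \<in> space M. \<forall>k\<in>{1..n}. \<eta> k \<omega> = e k}"

lemma cylinder_events [measurable]: "cylinder n e \<in> events"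
proof -
  have "{\<omega> \<in> space M. \<eta> k \<omega> = e k} \<in> events" if "k \<in> {1..n}" for k
    using measurable_sets[OF \<eta>_measurable, of k "{e k}"] that
    by (simp add: vimage_def Int_def conj_commute)
  then show ?thesis unfolding cylinder_def by (intro sets.sets_Collect_finite_All) auto
qed

text \<open>The conditional law is multiplied out so that null histories are covered too:
  \<open>next_step\<close> says nothing about them, but both sides vanish there.\<close>

lemma prob_cylinder_next:
  assumes n: "n \<ge> 1" and e: "e \<in> {1..n} \<rightarrow>\<^sub>E {-1, 1}" and s: "s \<in> {-1, 1}"
  shows "prob (cylinder n e \<inter> {\<omega> \<in> space M. \<eta> (n + 1) \<omega> = s}) =
    (1 + (2 * p - 1) * (s * walk e n) / n) / 2 * prob (cylinder n e)"
proof (cases "prob (cylinder n e) > 0")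
  case True
  have "(cylinder n e \<inter> {\<omega> \<in> space M. \<eta> (n + 1) \<omega> = s}) =
      {\<omega> \<in> space M. \<eta> (n + 1) \<omega> = s \<and> (\<forall>k\<in>{1..n}. \<eta> k \<omega> = e k)}"
    by (auto simp: cylinder_def)
  then have "prob (cylinder n e \<inter> {\<omega> \<in> space M. \<eta> (n + 1) \<omega> = s}) =
      pmf (erw_step p n e) s * prob (cylinder n e)"
    using next_step[OF n s, of e] True by (simp add: cond_prob_def cylinder_def divide_simps)
  also have "pmf (erw_step p n e) s = (1 + (2 * p - 1) * (s * walk e n) / n) / 2"
  proof -
    have "(\<Sum>k=1..n. 1 + (2 * p - 1) * real_of_int (e k) * real_of_int s) =
        (\<Sum>k=1..n. 1 + (2 * p - 1) * s * real_of_int (e k))"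
      by (simp add: mult_ac)
    also have "\<dots> = n + (2 * p - 1) * s * walk e n"
      by (simp add: sum.distrib sum_distrib_left walk_def)
    finally show ?thesis
      using pmf_erw_step[OF p n _ s, of e] e n by (simp add: PiE_iff field_simps)
  qed
  finally show ?thesis .
next
  case False
  then have "prob (cylinder n e) = 0" using measure_nonneg[of M "cylinder n e"] by linarith
  moreover have "prob (cylinder n e \<inter> {\<omega> \<in> space M. \<eta> (n + 1) \<omega> = s}) \<le> prob (cylinder n e)"
    by (intro finite_measure_mono) auto
  ultimately show ?thesis by (simp add: measure_le_0_iff)
qed

text \<open>A function of the first \<open>n\<close> steps takes finitely many values, one on each
  cylinder. The extra event \<open>A\<close> leaves room for the next step.\<close>

lemma
  fixes g :: "(nat \<Rightarrow> int) \<Rightarrow> real"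
  assumes g: "\<And>e e'. (\<And>k. k \<in> {1..n} \<Longrightarrow> e k = e' k) \<Longrightarrow> g e = g e'" and A: "A \<in> events"
  shows expectation_history: "expectation (\<lambda>\<omega>. g (\<lambda>k. \<eta> k \<omega>) * indicator A \<omega>) =
      (\<Sum>e\<in>{1..n} \<rightarrow>\<^sub>E {-1, 1}. g e * prob (cylinder n e \<inter> A))" (is ?E)
    and integrable_history: "integrable M (\<lambda>\<omega>. g (\<lambda>k. \<eta> k \<omega>) * indicator A \<omega>)" (is ?I)
proof -
  let ?H = "{1..n} \<rightarrow>\<^sub>E {-1, 1 :: int}"
  have fin: "finite ?H" by (intro finite_PiE) auto
  have eq: "g (\<lambda>k. \<eta> k \<omega>) * indicator A \<omega> = (\<Sum>e\<in>?H. g e * indicator (cylinder n e \<inter> A) \<omega>)"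
    if \<omega>: "\<omega> \<in> space M" for \<omega>
  proof -
    define e0 where "e0 = restrict (\<lambda>k. \<eta> k \<omega>) {1..n}"
    have e0: "e0 \<in> ?H" using \<eta>_values \<omega> by (auto simp: e0_def)
    \<comment> \<open>Histories are extensional functions, so each outcome lies in exactly one of
      the cylinders.\<close>
    have "\<omega> \<in> cylinder n e \<longleftrightarrow> e = e0" if "e \<in> ?H" for e
    proof
      assume "\<omega> \<in> cylinder n e"
      then show "e = e0" by (intro PiE_ext[OF that e0]) (auto simp: cylinder_def e0_def)
    qed (use \<omega> in \<open>auto simp: cylinder_def e0_def\<close>)
    then have "(\<Sum>e\<in>?H. g e * indicator (cylinder n e \<inter> A) \<omega>) =
        (\<Sum>e\<in>?H. if e = e0 then g e0 * indicator A \<omega> else 0)"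
      by (intro sum.cong) (auto simp: indicator_def)
    also have "\<dots> = g e0 * indicator A \<omega>" using fin e0 by simp
    also have "g e0 = g (\<lambda>k. \<eta> k \<omega>)" by (rule g) (simp add: e0_def)
    finally show ?thesis by simp
  qed
  have int: "integrable M (\<lambda>\<omega>. g e * indicator (cylinder n e \<inter> A) \<omega>)" for e
    using A by (intro integrable_mult_right integrable_real_indicator) (auto simp: emeasure_eq_measure)
  show ?I by (subst Bochner_Integration.integrable_cong[OF refl eq]) (auto intro: int)
  have "expectation (\<lambda>\<omega>. g (\<lambda>k. \<eta> k \<omega>) * indicator A \<omega>) =
      expectation (\<lambda>\<omega>. \<Sum>e\<in>?H. g e * indicator (cylinder n e \<inter> A) \<omega>)"
    by (rule Bochner_Integration.integral_cong[OF refl eq])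
  also have "\<dots> = (\<Sum>e\<in>?H. g e * prob (cylinder n e \<inter> A))"
    using int A by (subst Bochner_Integration.integral_sum) auto
  finally show ?E .
qed

lemma integrable_history':
  fixes g :: "(nat \<Rightarrow> int) \<Rightarrow> real"
  assumes g: "\<And>e e'. (\<And>k. k \<in> {1..n} \<Longrightarrow> e k = e' k) \<Longrightarrow> g e = g e'"
  shows "integrable M (\<lambda>\<omega>. g (\<lambda>k. \<eta> k \<omega>))"
proof -
  have "integrable M (\<lambda>\<omega>. g (\<lambda>k. \<eta> k \<omega>) * indicator (space M) \<omega>)"
    using g by (rule integrable_history) auto
  then show ?thesis
    by (rule Bochner_Integration.integrable_cong[THEN iffD1, OF refl, rotated]) simp
qed

text \<open>An elementary tower property: under the expectation, the indicator of the next step is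
  replaced by its conditional probability, history by history.\<close>

lemma expectation_next:
  fixes g :: "(nat \<Rightarrow> int) \<Rightarrow> real"
  assumes n: "n \<ge> 1" and s: "s \<in> {-1, 1}"
    and g: "\<And>e e'. (\<And>k. k \<in> {1..n} \<Longrightarrow> e k = e' k) \<Longrightarrow> g e = g e'"
  shows "expectation (\<lambda>\<omega>. g (\<lambda>k. \<eta> k \<omega>) * indicator {\<omega> \<in> space M. \<eta> (n + 1) \<omega> = s} \<omega>) =
    expectation (\<lambda>\<omega>. g (\<lambda>k. \<eta> k \<omega>) * ((1 + (2 * p - 1) * (s * X n \<omega>) / n) / 2))"
proof -
  define h where "h e = g e * ((1 + (2 * p - 1) * (s * walk e n) / n) / 2)" for e
  have h: "h e = h e'" if "\<And>k. k \<in> {1..n} \<Longrightarrow> e k = e' k" for e e'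
  proof -
    have "g e = g e'" using that by (rule g)
    moreover have "walk e n = walk e' n" using that by (rule walk_cong) auto
    ultimately show ?thesis by (simp only: h_def)
  qed
  have "expectation (\<lambda>\<omega>. g (\<lambda>k. \<eta> k \<omega>) * indicator {\<omega> \<in> space M. \<eta> (n + 1) \<omega> = s} \<omega>) =
      (\<Sum>e\<in>{1..n} \<rightarrow>\<^sub>E {-1, 1}. g e * prob (cylinder n e \<inter> {\<omega> \<in> space M. \<eta> (n + 1) \<omega> = s}))"
    using g by (rule expectation_history) auto
  also have "\<dots> = (\<Sum>e\<in>{1..n} \<rightarrow>\<^sub>E {-1, 1}. h e * prob (cylinder n e))"
    by (rule sum.cong[OF refl]) (simp only: prob_cylinder_next[OF n _ s] h_def mult.assoc)
  also have "\<dots> = (\<Sum>e\<in>{1..n} \<rightarrow>\<^sub>E {-1, 1}. h e * prob (cylinder n e \<inter> space M))"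
    by (simp add: sets.sets_into_space)
  also have "\<dots> = expectation (\<lambda>\<omega>. h (\<lambda>k. \<eta> k \<omega>) * indicator (space M) \<omega>)"
    by (rule expectation_history[symmetric, OF h]) auto
  also have "\<dots> = expectation (\<lambda>\<omega>. g (\<lambda>k. \<eta> k \<omega>) * ((1 + (2 * p - 1) * (s * X n \<omega>) / n) / 2))"
    by (intro Bochner_Integration.integral_cong refl) (simp add: h_def X_eq_walk)
  finally show ?thesis .
qed

section \<open>Descent below every level\<close>

text \<open>The sign \<open>s\<close> lets one argument serve both directions. For
  \<open>n < N\<close> the event is the whole space.\<close>

definition above :: "int \<Rightarrow> nat \<Rightarrow> nat \<Rightarrow> nat \<Rightarrow> 'a set" where
  "above s m N n = {\<omega> \<in> space M. \<forall>j\<in>{N..n}. - int m < s * X j \<omega>}"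

lemma above_events [measurable]: "above s m N n \<in> events"
proof -
  have "(\<lambda>\<omega>. s * X j \<omega>) -` {- int m<..} \<inter> space M \<in> events" for j
    by (rule measurable_sets[of _ _ "count_space UNIV"]) auto
  then have "{\<omega> \<in> space M. - int m < s * X j \<omega>} \<in> events" for j
    by (simp add: vimage_def Int_def conj_commute)
  then show ?thesis unfolding above_def by (intro sets.sets_Collect_finite_All) auto
qed

lemma integrable_above:
  fixes f :: "real \<Rightarrow> real"
  shows "integrable M (\<lambda>\<omega>. f (s * X n \<omega>) * indicator (above s m N n) \<omega>)"
proof -
  define g where "g e = f (s * walk e n) * of_bool (\<forall>j\<in>{N..n}. - int m < s * walk e j)" for e
  have "g e = g e'" if "\<And>k. k \<in> {1..n} \<Longrightarrow> e k = e' k" for e e'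
    using walk_cong[of n e e', OF that] by (simp add: g_def)
  then have "integrable M (\<lambda>\<omega>. g (\<lambda>k. \<eta> k \<omega>))" by (rule integrable_history')
  then show ?thesis
    by (rule Bochner_Integration.integrable_cong[THEN iffD1, OF refl, rotated])
       (auto simp: g_def above_def X_eq_walk indicator_def)
qed

text \<open>The event is decided by time \<open>n\<close> while \<open>f\<close> looks one step
  further, so the next step can be averaged out by \<open>expectation_next\<close>.\<close>

lemma
  fixes f :: "real \<Rightarrow> real"
  assumes n: "n \<ge> 1" and s: "s \<in> {-1, 1}"
  defines "d \<equiv> \<lambda>\<omega>. (2 * p - 1) * (s * X n \<omega>) / n"
  shows expectation_above_step: "expectation (\<lambda>\<omega>. f (s * X (Suc n) \<omega>) * indicator (above s m N n) \<omega>) =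
    expectation (\<lambda>\<omega>. ((1 + d \<omega>) / 2 * f (s * X n \<omega> + 1) + (1 - d \<omega>) / 2 * f (s * X n \<omega> - 1))
      * indicator (above s m N n) \<omega>)"
    and integrable_above_step: "integrable M (\<lambda>\<omega>. f (s * X (Suc n) \<omega>) * indicator (above s m N n) \<omega>)"
proof -
  \<comment> \<open>Freezing the next increment of \<open>s X\<close> at \<open>b\<close> leaves a
    function of the first \<open>n\<close> steps only.\<close>
  define g where "g b e = f (s * walk e n + b)
      * of_bool (\<forall>j\<in>{N..n}. - int m < s * walk e j)" for e and b :: int
  have g: "g b e = g b e'" if "\<And>k. k \<in> {1..n} \<Longrightarrow> e k = e' k" for e e' b
    using walk_cong[of n e e', OF that] by (simp add: g_def)
  let ?G = "\<lambda>b \<omega>. g b (\<lambda>k. \<eta> k \<omega>)"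
  let ?S = "\<lambda>b \<omega>. indicator {\<omega> \<in> space M. \<eta> (n + 1) \<omega> = b} \<omega> :: real"
  have G: "?G b \<omega> = f (s * X n \<omega> + b) * indicator (above s m N n) \<omega>" if "\<omega> \<in> space M" for b \<omega>
    using that by (auto simp: g_def above_def X_eq_walk indicator_def)
  have eq: "f (s * X (Suc n) \<omega>) * indicator (above s m N n) \<omega> = ?G 1 \<omega> * ?S s \<omega> + ?G (-1) \<omega> * ?S (-s) \<omega>"
    if \<omega>: "\<omega> \<in> space M" for \<omega>
  proof -
    have "s \<noteq> - s" using s by auto
    consider "\<eta> (n + 1) \<omega> = s" "s * X (Suc n) \<omega> = s * X n \<omega> + 1"
      | "\<eta> (n + 1) \<omega> = - s" "s * X (Suc n) \<omega> = s * X n \<omega> - 1"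
      using \<omega> s \<eta>_values[of "n + 1" \<omega>] X_Suc[of \<omega> n] by (auto simp: algebra_simps)
    then show ?thesis
    proof cases
      case 1
      then show ?thesis unfolding 1(2) using \<omega> \<open>s \<noteq> - s\<close> by (simp add: G)
    next
      case 2
      then show ?thesis unfolding 2(2) using \<omega> \<open>s \<noteq> - s\<close> by (simp add: G)
    qed
  qed
  have int: "integrable M (\<lambda>\<omega>. ?G b \<omega> * ?S c \<omega>)" for b c
    using g by (rule integrable_history) auto
  have "integrable M (\<lambda>\<omega>. ?G 1 \<omega> * ?S s \<omega> + ?G (-1) \<omega> * ?S (-s) \<omega>)"
    by (rule Bochner_Integration.integrable_add[OF int int])
  moreover have "integrable M (\<lambda>\<omega>. f (s * X (Suc n) \<omega>) * indicator (above s m N n) \<omega>) \<longleftrightarrow>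
      integrable M (\<lambda>\<omega>. ?G 1 \<omega> * ?S s \<omega> + ?G (-1) \<omega> * ?S (-s) \<omega>)"
    by (rule Bochner_Integration.integrable_cong[OF refl]) (rule eq)
  ultimately show "integrable M (\<lambda>\<omega>. f (s * X (Suc n) \<omega>) * indicator (above s m N n) \<omega>)"
    by (simp only:)
  have int': "integrable M (\<lambda>\<omega>. ?G b \<omega> * ((1 + (2 * p - 1) * (c * X n \<omega>) / n) / 2))" for b c :: int
  proof -
    define h where "h e = g b e * ((1 + (2 * p - 1) * (c * walk e n) / n) / 2)" for e
    have "h e = h e'" if "\<And>k. k \<in> {1..n} \<Longrightarrow> e k = e' k" for e e'
    proof -
      have "g b e = g b e'" using that by (rule g)
      moreover have "walk e n = walk e' n" using that by (rule walk_cong) auto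
      ultimately show ?thesis by (simp only: h_def)
    qed
    then have "integrable M (\<lambda>\<omega>. h (\<lambda>k. \<eta> k \<omega>))" by (rule integrable_history')
    then show ?thesis
      by (rule Bochner_Integration.integrable_cong[THEN iffD1, OF refl, rotated]) (simp add: h_def X_eq_walk)
  qed
  have s': "- s \<in> {-1, 1}" using s by auto
  have next_eq: "expectation (\<lambda>\<omega>. ?G b \<omega> * ?S c \<omega>) =
      expectation (\<lambda>\<omega>. ?G b \<omega> * ((1 + (2 * p - 1) * (c * X n \<omega>) / n) / 2))"
    if "c \<in> {-1, 1}" for b c
    by (rule expectation_next[OF n that]) (rule g)
  have "expectation (\<lambda>\<omega>. f (s * X (Suc n) \<omega>) * indicator (above s m N n) \<omega>) =
      expectation (\<lambda>\<omega>. ?G 1 \<omega> * ?S s \<omega> + ?G (-1) \<omega> * ?S (-s) \<omega>)"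
    by (rule Bochner_Integration.integral_cong[OF refl eq])
  also have "\<dots> = expectation (\<lambda>\<omega>. ?G 1 \<omega> * ((1 + (2 * p - 1) * (s * X n \<omega>) / n) / 2)) +
      expectation (\<lambda>\<omega>. ?G (-1) \<omega> * ((1 + (2 * p - 1) * ((-s) * X n \<omega>) / n) / 2))"
    by (simp only: Bochner_Integration.integral_add[OF int int] next_eq[OF s] next_eq[OF s'])
  also have "\<dots> = expectation (\<lambda>\<omega>. ?G 1 \<omega> * ((1 + (2 * p - 1) * (s * X n \<omega>) / n) / 2) +
      ?G (-1) \<omega> * ((1 + (2 * p - 1) * ((-s) * X n \<omega>) / n) / 2))"
    by (rule Bochner_Integration.integral_add[OF int' int', symmetric])
  also have "\<dots> = expectation (\<lambda>\<omega>. ((1 + d \<omega>) / 2 * f (s * X n \<omega> + 1) + (1 - d \<omega>) / 2 * f (s * X n \<omega> - 1))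
      * indicator (above s m N n) \<omega>)"
  proof (rule Bochner_Integration.integral_cong[OF refl])
    fix \<omega> assume \<omega>: "\<omega> \<in> space M"
    have *: "(2 * p - 1) * real_of_int (s * X n \<omega>) / n = d \<omega>"
      "(2 * p - 1) * real_of_int ((- s) * X n \<omega>) / n = - d \<omega>"
      by (simp_all add: d_def)
    show "?G 1 \<omega> * ((1 + (2 * p - 1) * (s * X n \<omega>) / n) / 2) +
        ?G (-1) \<omega> * ((1 + (2 * p - 1) * ((-s) * X n \<omega>) / n) / 2) =
      ((1 + d \<omega>) / 2 * f (s * X n \<omega> + 1) + (1 - d \<omega>) / 2 * f (s * X n \<omega> - 1))
        * indicator (above s m N n) \<omega>"
      unfolding * G[OF \<omega>] by (simp add: algebra_simps)
  qed
  finally show "expectation (\<lambda>\<omega>. f (s * X (Suc n) \<omega>) * indicator (above s m N n) \<omega>) = \<dots>" .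
qed

lemma prob_stays_above:
  assumes p_le: "p \<le> 3 / 4" and s: "s \<in> {-1, 1}"
  shows "prob {\<omega> \<in> space M. \<forall>j\<ge>N. - int m < s * X j \<omega>} = 0"
proof (rule ccontr)
  let ?A = "{\<omega> \<in> space M. \<forall>j\<ge>N. - int m < s * X j \<omega>}"
  define \<rho> where "\<rho> = prob ?A"
  assume "prob ?A \<noteq> 0"
  then have \<rho>: "\<rho> > 0" using measure_nonneg[of M ?A] by (simp add: \<rho>_def less_le)
  have "\<forall>\<^sub>F n in sequentially. 1 \<le> n \<and> N \<le> n \<and> 2 * real m \<le> real n \<and>
      32 * real m * (real m + 2) \<le> sqrt (2 * real n + 1)"
    by (intro eventually_conj eventually_ge_at_top) real_asymp+
  then obtain N0 where N0: "\<And>n. n \<ge> N0 \<Longrightarrow> 1 \<le> n \<and> N \<le> n \<and> 2 * real m \<le> real n \<and>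
      32 * real m * (real m + 2) \<le> sqrt (2 * real n + 1)"
    unfolding eventually_sequentially by blast
  \<comment> \<open>Watching only from \<open>N0 \<ge> N\<close> on enlarges the event, and the
    drift estimates apply at all times from \<open>N0\<close> on.\<close>
  let ?D = "above s m N0"
  define V where "V n \<omega> = lyap m n (s * X n \<omega>)" for n \<omega>
  define v where "v n = expectation (\<lambda>\<omega>. V n \<omega> * indicator (?D n) \<omega>)" for n
  define d where "d n \<omega> = (2 * p - 1) * (s * X n \<omega>) / n" for n \<omega>
  \<comment> \<open>\<open>U n\<close> plays the role of the conditional expectation of
    \<open>V (Suc n)\<close> given the first \<open>n\<close> steps.\<close>
  define U where "U n \<omega> = (1 + d n \<omega>) / 2 * lyap m (Suc n) (s * X n \<omega> + 1) +
    (1 - d n \<omega>) / 2 * lyap m (Suc n) (s * X n \<omega> - 1)" for n \<omega>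
  have above: "real_of_int (s * X n \<omega>) + real m \<ge> 1" if "n \<ge> N0" "\<omega> \<in> ?D n" for n \<omega>
  proof -
    have "- int m < s * X n \<omega>" using that by (simp add: above_def)
    then show ?thesis by linarith
  qed
  have V_nonneg: "V n \<omega> \<ge> 0" if "n \<ge> N0" "\<omega> \<in> ?D n" for n \<omega>
    using above[OF that] N0[OF that(1)] by (auto simp: V_def intro!: lyap_nonneg)
  \<comment> \<open>One step from above \<open>- m\<close> cannot pass below \<open>- m\<close>.
    Hence discarding the paths that hit \<open>- m\<close> at time \<open>n + 1\<close> only lowers
    the expectation.\<close>
  have V_Suc_nonneg: "V (Suc n) \<omega> \<ge> 0" if "n \<ge> N0" "\<omega> \<in> ?D n" for n \<omega>
  proof -
    have "\<omega> \<in> space M" using that by (simp add: above_def)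
    then have "s * X (Suc n) \<omega> \<ge> s * X n \<omega> - 1"
      using s \<eta>_values[of "n + 1" \<omega>] X_Suc[of \<omega> n] by (auto simp: algebra_simps)
    then have "real_of_int (s * X (Suc n) \<omega>) + real m \<ge> 0" using above[OF that] by linarith
    then show ?thesis unfolding V_def by (intro lyap_nonneg) auto
  qed
  have D: "integrable M (\<lambda>\<omega>. c * indicator (?D n) \<omega>)"
    "expectation (\<lambda>\<omega>. c * indicator (?D n) \<omega>) = c * prob (?D n)" for n and c :: real
    using above_events[of s m N0 n] by (auto simp: emeasure_eq_measure intro!: integrable_real_indicator)
  have V_int: "integrable M (\<lambda>\<omega>. V n \<omega> * indicator (?D n) \<omega>)" for n
    unfolding V_def by (rule integrable_above)
  have v_nonneg: "v n \<ge> 0" if "n \<ge> N0" for n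
    unfolding v_def using V_nonneg[OF that]
    by (intro Bochner_Integration.integral_nonneg) (auto simp: indicator_def)
  have v_Suc: "v (Suc n) \<le> expectation (\<lambda>\<omega>. U n \<omega> * indicator (?D n) \<omega>)" if n: "n \<ge> N0" for n
  proof -
    have n1: "n \<ge> 1" using N0[OF n] by simp
    have "v (Suc n) \<le> expectation (\<lambda>\<omega>. V (Suc n) \<omega> * indicator (?D n) \<omega>)"
      unfolding v_def
    proof (rule integral_mono[OF V_int])
      show "integrable M (\<lambda>\<omega>. V (Suc n) \<omega> * indicator (?D n) \<omega>)"
        unfolding V_def by (rule integrable_above_step[OF n1 s])
      show "V (Suc n) \<omega> * indicator (?D (Suc n)) \<omega> \<le> V (Suc n) \<omega> * indicator (?D n) \<omega>" for \<omega>
        using V_Suc_nonneg[OF n, of \<omega>] by (auto simp: indicator_def above_def)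
    qed
    also have "\<dots> = expectation (\<lambda>\<omega>. U n \<omega> * indicator (?D n) \<omega>)"
      unfolding V_def U_def d_def by (rule expectation_above_step[OF n1 s])
    finally show ?thesis .
  qed
  have U_int: "integrable M (\<lambda>\<omega>. U n \<omega> * indicator (?D n) \<omega>)" for n
    using integrable_above[of "\<lambda>x. (1 + (2 * p - 1) * x / n) / 2 * lyap m (Suc n) (x + 1) +
      (1 - (2 * p - 1) * x / n) / 2 * lyap m (Suc n) (x - 1)" s n m N0]
    by (simp add: U_def d_def)
  have x: "\<bar>real_of_int (s * X n \<omega>)\<bar> \<le> real n" if "\<omega> \<in> ?D n" for n \<omega>
    using abs_X_le[of \<omega> n] that s by (auto simp: above_def abs_mult)
  have \<alpha>: "-1 \<le> 2 * p - 1" "2 * p - 1 \<le> 1 / 2" using p p_le by auto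
  have drift: "U n \<omega> \<le> V n \<omega>" if n: "n \<ge> N0" and \<omega>: "\<omega> \<in> ?D n" for n \<omega>
  proof -
    note * = N0[OF n]
    have "\<bar>(2 * p - 1) * (s * X n \<omega>)\<bar> \<le> 1 * real n"
      unfolding abs_mult[of "2 * p - 1"] using \<alpha> x[OF \<omega>] by (intro mult_mono) auto
    then have "\<bar>d n \<omega>\<bar> \<le> 1" using * by (simp add: d_def divide_simps)
    then have "(d n \<omega>)\<^sup>2 \<le> 1" by (simp add: abs_square_le_1)
    then have "0 \<le> (1 - (d n \<omega>)\<^sup>2) / (16 * (2 * real n + 1) * ((V n \<omega>)\<^sup>2 + 1) * V n \<omega>)"
      using V_nonneg[OF n \<omega>] by (intro divide_nonneg_nonneg mult_nonneg_nonneg) auto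
    then show ?thesis
      using lyap_drift[of n "real m" "s * X n \<omega>" "2 * p - 1"] * above[OF n \<omega>] x[OF \<omega>] \<alpha>
      unfolding U_def V_def d_def by simp
  qed
  have v_mono: "v (Suc n) \<le> v n" if n: "n \<ge> N0" for n
  proof -
    have "expectation (\<lambda>\<omega>. U n \<omega> * indicator (?D n) \<omega>) \<le> v n"
      unfolding v_def using drift[OF n]
      by (intro integral_mono U_int V_int) (auto simp: indicator_def)
    with v_Suc[OF n] show ?thesis by simp
  qed
  have v_le: "v n \<le> v N0" if "n \<ge> N0" for n
    using that by (induction rule: dec_induct) (use v_mono in force)+
  \<comment> \<open>Monotonicity asks for measurability of the larger event only.\<close>
  have \<rho>_le: "\<rho> \<le> prob (?D n)" for n
    unfolding \<rho>_def using N0[of N0] above_events[of s m N0 n]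
    by (intro finite_measure_mono) (auto simp: above_def)
  \<comment> \<open>The summand 1 keeps \<open>K\<close> positive even if
    \<open>v N0 = 0\<close>.\<close>
  define K where "K = 2 * v N0 / \<rho> + 1"
  have K: "K > 0" "v N0 / K \<le> \<rho> / 2"
    using v_nonneg[of N0] \<rho> by (auto simp: K_def add_nonneg_pos field_simps)
  define c where "c = 1 / (96 * (K\<^sup>2 + 1) * K)"
  have c: "c > 0" using K by (auto simp: c_def intro!: divide_pos_pos mult_pos_pos add_nonneg_pos)
  obtain N1 :: nat where N1: "4 * K ^ 4 \<le> real N1" using real_arch_simple by blast
  have step: "v (Suc n) \<le> v n - c * (\<rho> / 2) / real n" if n: "n \<ge> max N0 N1" for n
  proof -
    have n0: "n \<ge> N0" using n by simp
    note * = N0[OF n0]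
    have "4 * K ^ 4 \<le> real n" using N1 n by linarith
    \<comment> \<open>As in Markov's inequality, \<open>1 - V / K\<close> is a lower bound for the
      indicator of \<open>V < K\<close>. Being affine in \<open>V\<close>, it has an expectation on
      \<open>?D n\<close> expressed by \<open>prob (?D n)\<close> and \<open>v n\<close>.\<close>
    then have U_le: "U n \<omega> \<le> V n \<omega> - c / n * (1 - V n \<omega> / K)" if \<omega>: "\<omega> \<in> ?D n" for \<omega>
    proof (cases "V n \<omega> < K")
      case True
      have "U n \<omega> \<le> V n \<omega> - c / n"
        using lyap_drift_strict[of n "real m" "s * X n \<omega>" "2 * p - 1" K] * above[OF n0 \<omega>] x[OF \<omega>] \<alpha>
          True \<open>4 * K ^ 4 \<le> real n\<close>
        unfolding U_def V_def d_def c_def by simp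
      moreover have "c / n * (1 - V n \<omega> / K) \<le> c / n * 1"
        using c K V_nonneg[OF n0 \<omega>] by (intro mult_left_mono) auto
      ultimately show ?thesis by simp
    next
      case False
      then have "c / n * (1 - V n \<omega> / K) \<le> 0"
        using c K by (intro mult_nonneg_nonpos) auto
      then show ?thesis using drift[OF n0 \<omega>] by simp
    qed
    have "v (Suc n) \<le> expectation (\<lambda>\<omega>. U n \<omega> * indicator (?D n) \<omega>)" by (rule v_Suc[OF n0])
    also have "\<dots> \<le> expectation (\<lambda>\<omega>. (1 + c / n / K) * (V n \<omega> * indicator (?D n) \<omega>) - c / n * indicator (?D n) \<omega>)"
      using U_le by (intro integral_mono U_int Bochner_Integration.integrable_diff D
        integrable_mult_right V_int) (auto simp: indicator_def algebra_simps)
    also have "\<dots> = (1 + c / n / K) * v n - c / n * prob (?D n)"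
      using V_int D by (subst Bochner_Integration.integral_diff) (auto simp: v_def)
    also have "\<dots> = v n - c / n * (prob (?D n) - v n / K)"
      by (simp add: algebra_simps)
    also have "\<dots> \<le> v n - c / n * (\<rho> / 2)"
    proof -
      have "v n / K \<le> v N0 / K" using v_le[OF n0] K by (intro divide_right_mono) auto
      then have "\<rho> / 2 \<le> prob (?D n) - v n / K" using K \<rho>_le[of n] by linarith
      then show ?thesis using c by (intro diff_left_mono mult_left_mono) auto
    qed
    finally show ?thesis by simp
  qed
  show False
  \<comment> \<open>Nonnegativity of \<open>v\<close> is known only from \<open>N0\<close> on, so
    the sequence is frozen before that time.\<close>
  proof (rule harmonic_descent_contradiction[where v = "\<lambda>n. v (max n N0)" and c = "c * (\<rho> / 2)"])
    show "0 < c * (\<rho> / 2)" using c \<rho> by simp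
    show "0 \<le> v (max n N0)" for n using v_nonneg by simp
    show "v (max (Suc n) N0) \<le> v (max n N0) - c * (\<rho> / 2) / real n" if "n \<ge> max N0 N1" for n
    proof -
      have "max (Suc n) N0 = Suc n" "max n N0 = n" using that by auto
      then show ?thesis using step[OF that] by simp
    qed
  qed
qed

lemma AE_goes_below:
  assumes p_le: "p \<le> 3 / 4" and s: "s \<in> {-1, 1}"
  shows "AE \<omega> in M. \<forall>m N. \<exists>j\<ge>N. s * X j \<omega> \<le> - int m"
proof -
  have "AE \<omega> in M. \<exists>j\<ge>N. s * X j \<omega> \<le> - int m" for m N
  proof -
    let ?A = "{\<omega> \<in> space M. \<forall>j\<ge>N. - int m < s * X j \<omega>}"
    \<comment> \<open>Measurability is essential here: \<open>prob\<close> is 0 by default on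
      non-measurable sets, so the value 0 alone would not give a null set.\<close>
    have "?A = (\<Inter>n. above s m N n)"
      by (auto simp: above_def) (meson atLeastAtMost_iff order_refl)
    moreover have "(\<Inter>n. above s m N n) \<in> events"
      by (intro sets.countable_INT) auto
    ultimately have "?A \<in> events" by (simp only:)
    then have "AE \<omega> in M. \<omega> \<notin> ?A"
      by (rule iffD1[OF prob_eq_0 prob_stays_above[OF p_le s]])
    then show ?thesis
      by (rule AE_mp) (auto simp: not_less)
  qed
  then show ?thesis by (simp add: AE_all_countable)
qed

end

section \<open>From unbounded descents to recurrence\<close>

lemma liminf_eq_minus_infinity:
  fixes x :: "nat \<Rightarrow> int"
  assumes "\<forall>m N. \<exists>j\<ge>N. x j \<le> - int m"
  shows "liminf (\<lambda>n. ereal (real_of_int (x n))) = - \<infinity>"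
proof (rule ccontr)
  let ?L = "liminf (\<lambda>n. ereal (real_of_int (x n)))"
  assume "?L \<noteq> - \<infinity>"
  then obtain B where "ereal B < ?L" by (metis ereal_dense2 ereal_infty_less_eq(2) less_ereal.simps(4) linorder_not_less)
  then have "\<forall>\<^sub>F n in sequentially. ereal B < ereal (real_of_int (x n))" by (rule less_LiminfD)
  then obtain N where N: "\<And>n. n \<ge> N \<Longrightarrow> B < real_of_int (x n)"
    by (auto simp: eventually_sequentially)
  obtain m :: nat where "- B \<le> real m" using real_arch_simple by blast
  moreover obtain j where "j \<ge> N" "x j \<le> - int m" using assms by blast
  ultimately show False using N[of j] by linarith
qed

theorem theorem3p1:
  fixes M :: "'a measure" and p r :: real and \<eta> X :: "nat \<Rightarrow> 'a \<Rightarrow> int"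
  assumes "elephant_random_walk M p r \<eta> X"
    and "p \<le> 3 / 4"
  shows "recurrent_walk M X"
proof -
  interpret elephant_random_walk M p r \<eta> X by fact
  let ?P = "\<lambda>\<omega>. liminf (\<lambda>n. ereal (real_of_int (X n \<omega>))) = - \<infinity> \<and>
               limsup (\<lambda>n. ereal (real_of_int (X n \<omega>))) = \<infinity>"
  have "AE \<omega> in M. ?P \<omega>"
    using AE_goes_below[OF assms(2), of 1, simplified] AE_goes_below[OF assms(2), of "-1", simplified]
  proof eventually_elim
    case (elim \<omega>)
    \<comment> \<open>The sign \<open>-1\<close> controls the reflected walk, whose liminf is minus
      the limsup of \<open>X\<close>.\<close>
    from elim(2) have "liminf (\<lambda>n. ereal (real_of_int (- X n \<omega>))) = - \<infinity>"
      by (intro liminf_eq_minus_infinity) auto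
    then have "limsup (\<lambda>n. ereal (real_of_int (X n \<omega>))) = \<infinity>"
      using ereal_Liminf_uminus[of sequentially "\<lambda>n. ereal (real_of_int (X n \<omega>))"] by simp
    with elim(1) show ?case by (auto intro!: liminf_eq_minus_infinity)
  qed
  moreover have "{\<omega> \<in> space M. ?P \<omega>} \<in> events"
  proof -
    have [measurable]: "(\<lambda>\<omega>. ereal (real_of_int (X n \<omega>))) \<in> borel_measurable M" for n
      by (rule measurable_compose[OF X_measurable]) simp
    show ?thesis by measurable
  qed
  ultimately show ?thesis
    unfolding recurrent_walk_def by (subst prob_Collect_eq_1) auto
qed

end
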